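(* Let $\Delta$ be a consistently oriented connectivity complex with vertex set $\{1,\ldots,N_V\}$, and let $Q_{\mathrm{ref}}\in\mathcal{M}_+(\Delta)$. Then the set $\mathcal{M}_+(\Delta;Q_{\mathrm{ref}})$ is (a) a path component of $\mathcal{M}_+(\Delta)$, and thus path-connected; (b) an open submanifold of $\mathbb{R}^{2\times N_V}$.
   Context: An abstract simplicial complex $\Delta$ over a finite set is a non-empty collection of non-empty subsets such that every non-empty subset of an element of $\Delta$ is in $\Delta$. Elements $\sigma\in\Delta$ are faces; $\sigma$ is an $m$-face if $\#\sigma=m+1$; the vertex set of $\Delta$ is the union of its faces. $\Delta$ is a simplicial $2$-complex if the largest dimension of its faces is $2$. It is pure if every maximal face has dimension $2$. It is $2$-path connected if for any two distinct $2$-faces $\sigma,\sigma'$ there is a finite sequence of $2$-faces $\sigma_0=\sigma,\ldots,\sigma_n=\sigma'$ such that $\sigma_i\cap\sigma_{i+1}$ is a $1$-face for all $i$. A connectivity complex is an abstract simplicial $2$-complex which is pure and $2$-path connected. An orientation of a $2$-face $\{i_0,i_1,i_2\}$ is an equivalence class $[i_0,i_1,i_2]$ of orderings modulo even permutations; it induces the orientations $[i_1,i_2],[i_2,i_0],[i_0,i_1]$ on its $1$-faces. $\Delta$ is consistently oriented if each $2$-face has an assigned orientation such that any two distinct $2$-faces sharing a $1$-face induce opposite orientations on that $1$-face. "$[i_0,i_1,i_2]$ is a $2$-face of $\Delta$" means that $\{i_0,i_1,i_2\}\in\Delta$ has assigned orientation $[i_0,i_1,i_2]$. For $Q=[Q_1,\ldots,Q_{N_V}]\in\mathbb{R}^{2\times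 N_V}$ with columns $Q_i\in\mathbb{R}^2$, let $\Sigma_\Delta(Q)=\{\operatorname{conv}\{Q_{i_0},\ldots,Q_{i_k}\} : \{i_0,\ldots,i_k\}\in\Delta\}$. A geometric simplicial complex in $\mathbb{R}^2$ is a non-empty finite set of simplices (convex hulls of affine independent points) containing all faces of its members and such that the non-empty intersection of any two members is a face of both. The abstract simplicial complex associated with $\Sigma_\Delta(Q)$ is $\{\sigma\subset\{1,\ldots,N_V\} : \operatorname{conv}\{Q_i\}_{i\in\sigma}\in\Sigma_\Delta(Q)\}$. Let $\mathcal{M}_0(\Delta)$ be the set of $Q\in\mathbb{R}^{2\times N_V}$ such that $\Sigma_\Delta(Q)$ is a geometric simplicial complex in $\mathbb{R}^2$ whose associated abstract simplicial complex is $\Delta$. The signed area is $A_Q(i_0,i_1,i_2)=\frac12\det[Q_{i_1}-Q_{i_0},\,Q_{i_2}-Q_{i_1}]$, and $$\mathcal{M}_+(\Delta)=\{Q\in\mathcal{M}_0(\Delta) : A_Q(i_0,i_1,i_2)>0 \text{ for all 2-faces } [i_0,i_1,i_2] \text{ of } \Delta\}.$$ For $Q_{\mathrm{ref}}\in\mathcal{M}_+(\Delta)$, the manifold of planar triangular meshes is $$\mathcal{M}_+(\Delta;Q_{\mathrm{ref}})=\{Q\in\mathcal{M}_+(\Delta) : \text{there exists a continuous path in } \mathcal{M}_+(\Delta) \text{ from } Q_{\mathrm{ref}} \text{ to } Q\}.$$ *)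

theory Defs
  imports "HOL-Analysis.Analysis" "HOL-Combinatorics.Permutations"
begin

definition abstract_simplicial_complex :: "'a set set \<Rightarrow> bool" where
  "abstract_simplicial_complex \<Delta> \<longleftrightarrow>
     finite (\<Union>\<Delta>) \<and> \<Delta> \<noteq> {} \<and> {} \<notin> \<Delta> \<and>
     (\<forall>\<sigma>\<in>\<Delta>. \<forall>\<tau>. \<tau> \<noteq> {} \<and> \<tau> \<subseteq> \<sigma> \<longrightarrow> \<tau> \<in> \<Delta>)"

definition m_faces :: "nat \<Rightarrow> 'a set set \<Rightarrow> 'a set set" where
  "m_faces m \<Delta> = {\<sigma>\<in>\<Delta>. card \<sigma> = m + 1}"

definition vertex_set :: "'a set set \<Rightarrow> 'a set" where
  "vertex_set \<Delta> = \<Union>\<Delta>"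

definition simplicial_2_complex :: "'a set set \<Rightarrow> bool" where
  "simplicial_2_complex \<Delta> \<longleftrightarrow>
     abstract_simplicial_complex \<Delta> \<and> m_faces 2 \<Delta> \<noteq> {} \<and>
     (\<forall>m. m_faces m \<Delta> \<noteq> {} \<longrightarrow> m \<le> 2)"

definition maximal_face :: "'a set set \<Rightarrow> 'a set \<Rightarrow> bool" where
  "maximal_face \<Delta> \<sigma> \<longleftrightarrow> \<sigma> \<in> \<Delta> \<and> (\<forall>\<tau>\<in>\<Delta>. \<sigma> \<subseteq> \<tau> \<longrightarrow> \<tau> = \<sigma>)"

definition pure_2 :: "'a set set \<Rightarrow> bool" where
  "pure_2 \<Delta> \<longleftrightarrow> (\<forall>\<sigma>. maximal_face \<Delta> \<sigma> \<longrightarrow> \<sigma> \<in> m_faces 2 \<Delta>)"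

definition two_path_connected :: "'a set set \<Rightarrow> bool" where
  "two_path_connected \<Delta> \<longleftrightarrow>
     (\<forall>\<sigma>\<in>m_faces 2 \<Delta>. \<forall>\<sigma>'\<in>m_faces 2 \<Delta>. \<sigma> \<noteq> \<sigma>' \<longrightarrow>
        (\<exists>(s :: nat \<Rightarrow> 'a set) n. s 0 = \<sigma> \<and> s n = \<sigma>' \<and>
           (\<forall>i\<le>n. s i \<in> m_faces 2 \<Delta>) \<and>
           (\<forall>i<n. s i \<inter> s (Suc i) \<in> m_faces 1 \<Delta>)))"

definition connectivity_complex :: "'a set set \<Rightarrow> bool" where
  "connectivity_complex \<Delta> \<longleftrightarrow>
     simplicial_2_complex \<Delta> \<and> pure_2 \<Delta> \<and> two_path_connected \<Delta>"

definition even_reordering :: "('a list \<times> 'a list) set" where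
  "even_reordering =
     {(xs, permute_list p xs) | xs p. p permutes {..<length xs} \<and> evenperm p}"

definition orderings :: "'a set \<Rightarrow> 'a list set" where
  "orderings \<sigma> = {xs. distinct xs \<and> set xs = \<sigma>}"

definition orientations :: "'a set \<Rightarrow> 'a list set set" where
  "orientations \<sigma> = orderings \<sigma> // even_reordering"

definition orientation_class :: "'a list \<Rightarrow> 'a list set" where
  "orientation_class xs = even_reordering `` {xs}"

definition induced_orientations :: "'a list set \<Rightarrow> 'a list set set" where
  "induced_orientations \<omega> =
     (\<Union>(i, j, k)\<in>{(i, j, k). \<omega> = orientation_class [i, j, k]}.
        {orientation_class [j, k], orientation_class [k, i], orientation_class [i, j]})"

text \<open>The map \<open>\<omega>\<close> carries the assigned orientations; only its values on 2-faces matter.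
  The two orientations of an edge \<open>{i, j}\<close> are the classes of \<open>[i, j]\<close> and \<open>[j, i]\<close>.\<close>

definition consistently_oriented :: "'a set set \<Rightarrow> ('a set \<Rightarrow> 'a list set) \<Rightarrow> bool" where
  "consistently_oriented \<Delta> \<omega> \<longleftrightarrow>
     (\<forall>\<sigma>\<in>m_faces 2 \<Delta>. \<omega> \<sigma> \<in> orientations \<sigma>) \<and>
     (\<forall>\<sigma>\<in>m_faces 2 \<Delta>. \<forall>\<tau>\<in>m_faces 2 \<Delta>. \<sigma> \<noteq> \<tau> \<longrightarrow>
        (\<forall>i j. {i, j} \<in> m_faces 1 \<Delta> \<and> {i, j} \<subseteq> \<sigma> \<and> {i, j} \<subseteq> \<tau> \<and>
           orientation_class [i, j] \<in> induced_orientations (\<omega> \<sigma>) \<longrightarrow>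
           orientation_class [j, i] \<in> induced_orientations (\<omega> \<tau>)))"

definition oriented_2_face ::
    "'a set set \<Rightarrow> ('a set \<Rightarrow> 'a list set) \<Rightarrow> 'a \<Rightarrow> 'a \<Rightarrow> 'a \<Rightarrow> bool" where
  "oriented_2_face \<Delta> \<omega> i j k \<longleftrightarrow>
     {i, j, k} \<in> m_faces 2 \<Delta> \<and> \<omega> {i, j, k} = orientation_class [i, j, k]"

text \<open>The vertices \<open>1, \<dots>, N\<close> are the elements of a finite type \<open>'n\<close>, and a matrix
  \<open>Q :: real^'n^2\<close> has two rows and \<open>N = CARD('n)\<close> columns.

  The predicate \<open>simplicial_complex\<close> of the library counts the empty set as a simplex and
  as a face, hence forces it to be a member; here members and faces are non-empty.\<close>

definition geometric_simplicial_complex :: "(real^2) set set \<Rightarrow> bool" where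
  "geometric_simplicial_complex K \<longleftrightarrow>
     K \<noteq> {} \<and> finite K \<and>
     (\<forall>S\<in>K. S \<noteq> {} \<and> (\<exists>n. n simplex S)) \<and>
     (\<forall>S\<in>K. \<forall>F. F face_of S \<and> F \<noteq> {} \<longrightarrow> F \<in> K) \<and>
     (\<forall>S\<in>K. \<forall>T\<in>K. S \<inter> T \<noteq> {} \<longrightarrow> S \<inter> T face_of S \<and> S \<inter> T face_of T)"

definition conv_columns :: "real^'n^2 \<Rightarrow> 'n set \<Rightarrow> (real^2) set" where
  "conv_columns Q \<sigma> = convex hull ((\<lambda>i. column i Q) ` \<sigma>)"

definition realization :: "'n set set \<Rightarrow> real^'n^2 \<Rightarrow> (real^2) set set" where
  "realization \<Delta> Q = conv_columns Q ` \<Delta>"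

definition associated_complex :: "'n set set \<Rightarrow> real^'n^2 \<Rightarrow> 'n set set" where
  "associated_complex \<Delta> Q = {\<sigma>. conv_columns Q \<sigma> \<in> realization \<Delta> Q}"

definition M_zero :: "'n set set \<Rightarrow> (real^'n^2) set" where
  "M_zero \<Delta> = {Q. geometric_simplicial_complex (realization \<Delta> Q) \<and>
                 associated_complex \<Delta> Q = \<Delta>}"

text \<open>The transpose makes the two vectors the columns of the matrix.\<close>

definition signed_area :: "real^'n^2 \<Rightarrow> 'n \<Rightarrow> 'n \<Rightarrow> 'n \<Rightarrow> real" where
  "signed_area Q i j k =
     1/2 * det (transpose (vector [column j Q - column i Q, column k Q - column j Q]) :: real^2^2)"

definition M_plus :: "'n set set \<Rightarrow> ('n set \<Rightarrow> 'n list set) \<Rightarrow> (real^'n^2) set" where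
  "M_plus \<Delta> \<omega> = {Q \<in> M_zero \<Delta>. \<forall>i j k. oriented_2_face \<Delta> \<omega> i j k \<longrightarrow> signed_area Q i j k > 0}"

definition mesh_manifold ::
    "'n set set \<Rightarrow> ('n set \<Rightarrow> 'n list set) \<Rightarrow> real^'n^2 \<Rightarrow> (real^'n^2) set" where
  "mesh_manifold \<Delta> \<omega> Qref =
     {Q \<in> M_plus \<Delta> \<omega>. \<exists>g. path g \<and> path_image g \<subseteq> M_plus \<Delta> \<omega> \<and>
        pathstart g = Qref \<and> pathfinish g = Q}"

end

theory Submission
  imports Defs
begin

text \<open>
  Everything reduces to the openness of \<^term>\<open>M_plus \<Delta> \<omega>\<close>: the set
  \<^term>\<open>mesh_manifold \<Delta> \<omega> Qref\<close> is by definition the path component of \<^term>\<open>Qref\<close> in it, and path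
  components of open subsets of a normed space are open. An open subset of Euclidean space
  is an open submanifold, so this is the manifold assertion.

  For the openness, a point configuration \<^term>\<open>Q\<close> is read as the linear map
  \<^term>\<open>(*v) Q\<close> that sends the \<open>i\<close>-th unit vector to the \<open>i\<close>-th column. It maps the standard
  geometric realization of \<^term>\<open>\<Delta>\<close> in the space of barycentric coordinates onto the union of
  the simplices in \<^term>\<open>realization \<Delta> Q\<close>. Positive signed areas make every
  2-face, and by purity every face, non-degenerate; under that condition the combinatorial
  requirement \<^term>\<open>Q \<in> M_zero \<Delta>\<close> says exactly that this map is injective
  (lemmas \<open>inj_on_realization_if_M_zero\<close> and \<open>M_zero_if_inj_on_realization\<close>).

  Injectivity of a linear map on a set concerns only the differences of points of the set. Up to
  positive scaling, those between the simplices of two faces \<open>\<sigma>\<close> and \<open>\<tau>\<close> are the vectors of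
  coordinate sum zero that are non-negative off \<open>\<tau>\<close> and non-positive off \<open>\<sigma>\<close>. They form a closed
  cone, and \<open>(*v) Q\<close> is injective on the realization iff its kernel meets the finitely many
  cones only in the origin (lemma \<open>inj_on_realization_iff\<close>). The unit vectors in a closed
  cone are compact, so this condition persists under small changes of \<open>Q\<close>. The passage to cones
  is what makes compactness applicable: distinct points of the realization can be arbitrarily
  close to each other, whereas a normalized difference stays away from the origin. It also
  treats disjoint faces, faces with a common vertex and faces with a common edge alike.
\<close>

section \<open>Barycentric coordinates\<close>

definition barycentric :: "'n set \<Rightarrow> (real^'n) set" where
  "barycentric \<sigma> = {a. (\<forall>i. 0 \<le> a $ i) \<and> (\<forall>i. i \<notin> \<sigma> \<longrightarrow> a $ i = 0) \<and> (\<Sum>i\<in>UNIV. a $ i) = 1}"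

definition standard_realization :: "'n set set \<Rightarrow> (real^'n) set" where
  "standard_realization \<Delta> = (\<Union>\<sigma>\<in>\<Delta>. barycentric \<sigma>)"

lemma matrix_mult_axis: "Q *v axis i 1 = column i (Q :: real^'n^'m)"
  by (simp add: matrix_vector_mult_def column_def axis_def vec_eq_iff if_distrib cong: if_cong)

lemma axis_in_barycentric: "i \<in> \<sigma> \<Longrightarrow> axis i 1 \<in> barycentric \<sigma>"
  by (auto simp: barycentric_def axis_def)

lemma barycentric_mono: "\<sigma> \<subseteq> \<tau> \<Longrightarrow> barycentric \<sigma> \<subseteq> barycentric \<tau>"
  by (auto simp: barycentric_def)

lemma barycentric_Int: "barycentric \<sigma> \<inter> barycentric \<tau> = barycentric (\<sigma> \<inter> \<tau>)"
  by (auto simp: barycentric_def)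

lemma barycentric_eq_hull: "barycentric \<sigma> = convex hull ((\<lambda>i. axis i (1::real)) ` \<sigma>)"
proof -
  have inj: "inj_on (\<lambda>i. axis i (1::real)) \<sigma>"
    by (auto simp: inj_on_def axis_eq_axis)
  have comb: "(\<Sum>i\<in>\<sigma>. u i *\<^sub>R axis i (1::real)) = (\<chi> j. if j \<in> \<sigma> then u j else 0)" for u
    by (simp add: vec_eq_iff axis_def if_distrib cong: if_cong)
  have "convex hull ((\<lambda>i. axis i (1::real)) ` \<sigma>) =
      {y. \<exists>u. (\<forall>i\<in>\<sigma>. 0 \<le> u (axis i 1)) \<and> (\<Sum>i\<in>\<sigma>. u (axis i (1::real))) = 1 \<and>
              (\<Sum>i\<in>\<sigma>. u (axis i 1) *\<^sub>R axis i (1::real)) = y}"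
    by (simp add: convex_hull_finite sum.reindex[OF inj] o_def)
  also have "\<dots> = barycentric \<sigma>"
  proof (intro set_eqI iffI)
    fix a assume "a \<in> barycentric \<sigma>"
    then have a: "\<And>i. 0 \<le> a $ i" "\<And>i. i \<notin> \<sigma> \<Longrightarrow> a $ i = 0" "(\<Sum>i\<in>UNIV. a $ i) = 1"
      by (auto simp: barycentric_def)
    have "(\<Sum>i\<in>\<sigma>. a $ i) = (\<Sum>i\<in>UNIV. a $ i)"
      by (rule sum.mono_neutral_left) (use a in auto)
    \<comment> \<open>The weights are functions of the points, here unit vectors; the scalar product with \<open>a\<close>
      sends the \<open>i\<close>-th one to its weight \<open>a $ i\<close>.\<close>
    moreover have "a \<bullet> axis i 1 = a $ i" for i
      by (simp add: inner_axis)
    moreover have "(\<chi> j. if j \<in> \<sigma> then a $ j else 0) = a"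
      using a by (simp add: vec_eq_iff)
    ultimately show "a \<in> {y. \<exists>u. (\<forall>i\<in>\<sigma>. 0 \<le> u (axis i 1)) \<and> (\<Sum>i\<in>\<sigma>. u (axis i (1::real))) = 1 \<and>
              (\<Sum>i\<in>\<sigma>. u (axis i 1) *\<^sub>R axis i (1::real)) = y}"
      using a by (intro CollectI exI[of _ "\<lambda>v. a \<bullet> v"]) (simp add: comb)
  next
    fix a assume "a \<in> {y. \<exists>u. (\<forall>i\<in>\<sigma>. 0 \<le> u (axis i 1)) \<and> (\<Sum>i\<in>\<sigma>. u (axis i (1::real))) = 1 \<and>
              (\<Sum>i\<in>\<sigma>. u (axis i 1) *\<^sub>R axis i (1::real)) = y}"
    then show "a \<in> barycentric \<sigma>"
      by (auto simp: comb barycentric_def sum.If_cases)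
  qed
  finally show ?thesis by simp
qed

lemma conv_columns_eq: "conv_columns Q \<sigma> = (*v) Q ` barycentric \<sigma>"
  unfolding barycentric_eq_hull conv_columns_def
  by (subst convex_hull_linear_image) (simp_all add: image_image matrix_mult_axis)

section \<open>Injectivity on the realization as a condition on the kernel\<close>

text \<open>The cone spanned by the differences \<open>a - b\<close> with \<open>a\<close> in the simplex of \<open>\<sigma>\<close> and \<open>b\<close> in that
  of \<open>\<tau>\<close>. The sign conditions force its elements to vanish outside \<open>\<sigma> \<union> \<tau>\<close>.\<close>

definition difference_cone :: "'n set \<Rightarrow> 'n set \<Rightarrow> (real^'n) set" where
  "difference_cone \<sigma> \<tau> =
     {c. (\<forall>i. i \<notin> \<tau> \<longrightarrow> 0 \<le> c $ i) \<and> (\<forall>i. i \<notin> \<sigma> \<longrightarrow> c $ i \<le> 0) \<and> (\<Sum>i\<in>UNIV. c $ i) = 0}"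

lemma diff_in_difference_cone:
  assumes "a \<in> barycentric \<sigma>" "b \<in> barycentric \<tau>"
  shows "a - b \<in> difference_cone \<sigma> \<tau>"
  using assms by (auto simp: barycentric_def difference_cone_def sum_subtractf)

text \<open>Split \<open>c\<close> into its positive and negative parts: the sign conditions put their supports into
  \<open>\<sigma>\<close> and \<open>\<tau>\<close>, and the two have the same total mass \<open>m\<close> because the coordinates of \<open>c\<close> sum to
  zero. Dividing both by \<open>m\<close> gives the two points.\<close>

lemma difference_coneE:
  fixes c :: "real^'n"
  assumes c: "c \<in> difference_cone \<sigma> \<tau>" and "c \<noteq> 0"
  obtains m a b where "m > 0" "a \<in> barycentric \<sigma>" "b \<in> barycentric \<tau>" "c = m *\<^sub>R (a - b)"
proof -
  define p n where "p = (\<chi> i. max (c $ i) 0)" and "n = (\<chi> i. max (- c $ i) 0)"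
  define m where "m = (\<Sum>i\<in>UNIV. p $ i)"
  have cpn: "c = p - n"
    by (auto simp: vec_eq_iff p_def n_def)
  have "(\<Sum>i\<in>UNIV. c $ i) = 0"
    using c by (simp add: difference_cone_def)
  then have mn: "m = (\<Sum>i\<in>UNIV. n $ i)"
    by (simp add: cpn sum_subtractf m_def)
  have nonneg: "0 \<le> p $ i" "0 \<le> n $ i" for i
    by (auto simp: p_def n_def)
  have "m \<noteq> 0"
  proof
    assume "m = 0"
    then have "p $ i = 0" "n $ i = 0" for i
      using nonneg mn m_def by (simp_all add: sum_nonneg_eq_0_iff)
    then show False
      using \<open>c \<noteq> 0\<close> cpn by (simp add: vec_eq_iff)
  qed
  moreover have "m \<ge> 0"
    by (simp add: m_def nonneg sum_nonneg)
  ultimately have "m > 0" by simp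
  show thesis
  proof
    show "m > 0" by fact
    show "(1/m) *\<^sub>R p \<in> barycentric \<sigma>" "(1/m) *\<^sub>R n \<in> barycentric \<tau>"
      using c \<open>m > 0\<close> nonneg
      by (auto simp: barycentric_def difference_cone_def p_def n_def simp flip: sum_divide_distrib)
        (use m_def mn \<open>m > 0\<close> p_def n_def in auto)
    show "c = m *\<^sub>R ((1/m) *\<^sub>R p - (1/m) *\<^sub>R n)"
      using \<open>m > 0\<close> by (simp add: cpn algebra_simps)
  qed
qed

lemma inj_on_realization_iff:
  fixes Q :: "real^'n^'m"
  shows "inj_on ((*v) Q) (standard_realization \<Delta>) \<longleftrightarrow>
     (\<forall>\<sigma>\<in>\<Delta>. \<forall>\<tau>\<in>\<Delta>. \<forall>c\<in>difference_cone \<sigma> \<tau>. Q *v c = 0 \<longrightarrow> c = 0)"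
proof safe
  fix \<sigma> \<tau> c
  assume inj: "inj_on ((*v) Q) (standard_realization \<Delta>)" and "\<sigma> \<in> \<Delta>" "\<tau> \<in> \<Delta>"
    and c: "c \<in> difference_cone \<sigma> \<tau>" and Qc: "Q *v c = 0"
  show "c = 0"
  proof (rule ccontr)
    assume "c \<noteq> 0"
    then obtain m a b where "m > 0" and ab: "a \<in> barycentric \<sigma>" "b \<in> barycentric \<tau>"
      and ceq: "c = m *\<^sub>R (a - b)"
      using difference_coneE[OF c] by blast
    have "Q *v a = Q *v b"
      using Qc \<open>m > 0\<close> by (simp add: ceq matrix_vector_mult_scaleR matrix_vector_mult_diff_distrib)
    then have "a = b"
      using inj ab \<open>\<sigma> \<in> \<Delta>\<close> \<open>\<tau> \<in> \<Delta>\<close> unfolding standard_realization_def inj_on_def by blast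
    with \<open>c \<noteq> 0\<close> ceq show False by simp
  qed
next
  assume ker: "\<forall>\<sigma>\<in>\<Delta>. \<forall>\<tau>\<in>\<Delta>. \<forall>c\<in>difference_cone \<sigma> \<tau>. Q *v c = 0 \<longrightarrow> c = 0"
  show "inj_on ((*v) Q) (standard_realization \<Delta>)"
  proof (rule inj_onI)
    fix a b assume "a \<in> standard_realization \<Delta>" "b \<in> standard_realization \<Delta>" "Q *v a = Q *v b"
    then obtain \<sigma> \<tau> where "\<sigma> \<in> \<Delta>" "\<tau> \<in> \<Delta>" "a - b \<in> difference_cone \<sigma> \<tau>" "Q *v (a - b) = 0"
      by (auto simp: standard_realization_def matrix_vector_mult_diff_distrib intro: diff_in_difference_cone)
    then show "a = b" using ker by fastforce
  qed
qed

section \<open>Openness of injectivity\<close>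

text \<open>By homogeneity only unit vectors of the cone need to be tested. The matrices that annihilate
  one of them form the projection, along a compact factor, of a closed set of pairs.\<close>

lemma open_kernel_avoids_cone:
  fixes C :: "(real^'n) set"
  assumes "closed C" and cone: "\<And>c r. c \<in> C \<Longrightarrow> r > 0 \<Longrightarrow> r *\<^sub>R c \<in> C"
  shows "open {Q :: real^'n^'m. \<forall>c\<in>C. Q *v c = 0 \<longrightarrow> c = 0}"
proof -
  let ?K = "C \<inter> sphere 0 1"
  have "compact ?K"
    using \<open>closed C\<close> by (intro closed_Int_compact) auto
  moreover have "continuous_on UNIV (\<lambda>(c :: real^'n, Q :: real^'n^'m). Q *v c)"
    unfolding case_prod_unfold matrix_vector_mult_def
    by (intro continuous_intros)
  then have "closed {(c :: real^'n, Q :: real^'n^'m). Q *v c = 0}"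
    using closed_Collect_eq[of "\<lambda>(c :: real^'n, Q :: real^'n^'m). Q *v c" "\<lambda>_. 0"]
    by (simp add: case_prod_unfold)
  ultimately have "closed {Q :: real^'n^'m. \<exists>c. c \<in> ?K \<and> (c, Q) \<in> {(c, Q). Q *v c = 0}}"
    by (rule closed_compact_projection)
  moreover have "{Q :: real^'n^'m. \<forall>c\<in>C. Q *v c = 0 \<longrightarrow> c = 0} =
      - {Q. \<exists>c. c \<in> ?K \<and> (c, Q) \<in> {(c, Q). Q *v c = 0}}"
  proof (intro set_eqI iffI)
    fix Q :: "real^'n^'m"
    assume Q: "Q \<in> - {Q. \<exists>c. c \<in> ?K \<and> (c, Q) \<in> {(c, Q). Q *v c = 0}}"
    show "Q \<in> {Q. \<forall>c\<in>C. Q *v c = 0 \<longrightarrow> c = 0}"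
    proof (rule CollectI, intro ballI impI, rule ccontr)
      fix c assume c: "c \<in> C" "Q *v c = 0" "c \<noteq> 0"
      then have "(1 / norm c) *\<^sub>R c \<in> ?K" "Q *v ((1 / norm c) *\<^sub>R c) = 0"
        using cone[of c "1 / norm c"] by (simp_all add: matrix_vector_mult_scaleR)
      then show False using Q by blast
    qed
  qed auto
  ultimately show ?thesis
    by (simp add: open_Compl)
qed

lemma open_inj_on_realization:
  "open {Q :: real^'n^'m. inj_on ((*v) Q) (standard_realization (\<Delta> :: 'n set set))}"
proof -
  let ?C = "\<Union>\<sigma>\<in>\<Delta>. \<Union>\<tau>\<in>\<Delta>. difference_cone \<sigma> \<tau> :: (real^'n) set"
  have "closed (difference_cone \<sigma> \<tau>)" for \<sigma> \<tau> :: "'n set"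
    unfolding difference_cone_def
    by (intro closed_Collect_conj closed_Collect_all closed_Collect_imp open_Collect_const
          closed_Collect_le closed_Collect_eq continuous_intros)
  then have "closed ?C"
    by (intro closed_UN) auto
  moreover have "r *\<^sub>R c \<in> ?C" if "c \<in> ?C" "r > 0" for c and r :: real
  proof -
    have "r *\<^sub>R c \<in> difference_cone \<sigma> \<tau>" if "c \<in> difference_cone \<sigma> \<tau>" for \<sigma> \<tau>
      using that \<open>r > 0\<close>
      by (simp add: difference_cone_def mult_le_0_iff flip: sum_distrib_left)
    then show ?thesis using \<open>c \<in> ?C\<close> by blast
  qed
  ultimately have "open {Q :: real^'n^'m. \<forall>c\<in>?C. Q *v c = 0 \<longrightarrow> c = 0}"
    by (rule open_kernel_avoids_cone)
  then show ?thesis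
    by (simp add: inj_on_realization_iff)
qed

section \<open>Non-degenerate faces\<close>

text \<open>For \<open>\<sigma> = \<tau>\<close> the elements of the difference cone are the coefficient vectors of affine
  relations: supported on \<open>\<sigma>\<close>, with sum zero. Affine dependence is a notion about sets of points
  and does not notice coinciding columns, hence the separate injectivity condition.\<close>

lemma inj_on_barycentric_iff:
  fixes Q :: "real^'n^2"
  shows "inj_on ((*v) Q) (barycentric \<sigma>) \<longleftrightarrow>
     inj_on (\<lambda>i. column i Q) \<sigma> \<and> \<not> affine_dependent ((\<lambda>i. column i Q) ` \<sigma>)"
    (is "?I \<longleftrightarrow> ?J \<and> \<not> ?D")
proof -
  have sum_supp: "(\<Sum>i\<in>UNIV. f i) = (\<Sum>i\<in>\<sigma>. f i)" if "\<And>i. i \<notin> \<sigma> \<Longrightarrow> f i = 0"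
    for f :: "'n \<Rightarrow> 'b::comm_monoid_add"
    by (rule sum.mono_neutral_right) (use that in auto)
  have mult: "Q *v c = (\<Sum>i\<in>\<sigma>. c $ i *\<^sub>R column i Q)" if "\<And>i. i \<notin> \<sigma> \<Longrightarrow> c $ i = 0" for c
    using that by (simp add: matrix_mult_sum scalar_mult_eq_scaleR sum_supp)
  have I: "?I \<longleftrightarrow> (\<forall>c\<in>difference_cone \<sigma> \<sigma>. Q *v c = 0 \<longrightarrow> c = 0)"
    using inj_on_realization_iff[of Q "{\<sigma>}"] by (simp add: standard_realization_def)
  have dep: "?D \<longleftrightarrow> (\<exists>U. (\<Sum>i\<in>\<sigma>. U (column i Q)) = 0 \<and> (\<exists>i\<in>\<sigma>. U (column i Q) \<noteq> 0) \<and>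
        (\<Sum>i\<in>\<sigma>. U (column i Q) *\<^sub>R column i Q) = 0)" if ?J
    by (simp add: affine_dependent_explicit_finite sum.reindex[OF that] o_def)
  show ?thesis
  proof (intro iffI conjI notI)
    assume inj: ?I
    show J: ?J
    proof (rule inj_onI)
      fix i j assume "i \<in> \<sigma>" "j \<in> \<sigma>" "column i Q = column j Q"
      then have "axis i (1::real) = axis j 1"
        using inj_onD[OF inj, of "axis i 1" "axis j 1"]
        by (simp add: matrix_mult_axis axis_in_barycentric)
      then show "i = j" by (simp add: axis_eq_axis)
    qed
    assume ?D
    then obtain U where U: "(\<Sum>i\<in>\<sigma>. U (column i Q)) = 0" "\<exists>i\<in>\<sigma>. U (column i Q) \<noteq> 0"
      "(\<Sum>i\<in>\<sigma>. U (column i Q) *\<^sub>R column i Q) = 0"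
      using dep[OF J] by blast
    define c :: "real^'n" where "c = (\<chi> i. if i \<in> \<sigma> then U (column i Q) else 0)"
    have "c \<in> difference_cone \<sigma> \<sigma>" "Q *v c = 0"
      using U by (simp_all add: difference_cone_def c_def sum_supp mult)
    then have "c = 0" using inj I by blast
    moreover obtain i where "i \<in> \<sigma>" "U (column i Q) \<noteq> 0"
      using U(2) by blast
    then have "c $ i \<noteq> 0"
      by (simp add: c_def)
    ultimately show False by simp
  next
    assume J: "?J \<and> \<not> ?D"
    show ?I
      unfolding I
    proof (intro ballI impI, rule ccontr)
      fix c assume c: "c \<in> difference_cone \<sigma> \<sigma>" "Q *v c = 0" "c \<noteq> 0"
      have off: "c $ i = 0" if "i \<notin> \<sigma>" for i
        using c that by (force simp: difference_cone_def)
      \<comment> \<open>Coefficients of affine relations are indexed by points, so the entries of \<open>c\<close> are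
        transported along the injective map from indices to columns.\<close>
      define U where "U = (\<lambda>v. c $ inv_into \<sigma> (\<lambda>i. column i Q) v)"
      have U: "U (column i Q) = c $ i" if "i \<in> \<sigma>" for i
        using that J inv_into_f_f[of "\<lambda>i. column i Q" \<sigma> i] by (simp add: U_def)
      have "(\<Sum>i\<in>\<sigma>. c $ i) = 0"
        using c(1) by (simp add: difference_cone_def sum_supp off)
      moreover have "\<exists>i\<in>\<sigma>. c $ i \<noteq> 0"
        using c(3) off by (auto simp: vec_eq_iff)
      ultimately have ?D
        using c(2) off J by (subst dep) (auto intro!: exI[of _ U] simp: U mult)
      then show False using J by blast
    qed
  qed
qed

lemma signed_area_coords:
  "2 * signed_area Q i j k =
     (Q $ 1 $ j - Q $ 1 $ i) * (Q $ 2 $ k - Q $ 2 $ j) - (Q $ 1 $ k - Q $ 1 $ j) * (Q $ 2 $ j - Q $ 2 $ i)"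
  by (simp add: signed_area_def det_2 transpose_def column_def)

text \<open>An affine relation \<open>c\<close> among the three vertices is a linear relation between two edge
  vectors, so Cramer's rule multiplies its coefficients by the determinant and gives zero.\<close>

lemma inj_on_barycentric_triangle:
  fixes Q :: "real^'n^2"
  assumes "distinct [i, j, k]" and area: "signed_area Q i j k \<noteq> 0"
  shows "inj_on ((*v) Q) (barycentric {i, j, k})"
proof (rule inj_onI)
  fix a b assume ab: "a \<in> barycentric {i, j, k}" "b \<in> barycentric {i, j, k}" "Q *v a = Q *v b"
  define c where "c = a - b"
  have off: "c $ l = 0" if "l \<notin> {i, j, k}" for l
    using ab that by (auto simp: c_def barycentric_def)
  have total: "(\<Sum>l\<in>UNIV. f l * c $ l) = f i * c $ i + f j * c $ j + f k * c $ k" for f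
  proof -
    have "(\<Sum>l\<in>UNIV. f l * c $ l) = (\<Sum>l\<in>{i, j, k}. f l * c $ l)"
      by (rule sum.mono_neutral_right) (use off in auto)
    then show ?thesis using \<open>distinct [i, j, k]\<close> by simp
  qed
  have "Q *v c = 0" "(\<Sum>l\<in>UNIV. c $ l) = 0"
    using ab by (simp_all add: c_def matrix_vector_mult_diff_distrib barycentric_def sum_subtractf)
  then have eqs: "Q $ 1 $ i * c $ i + Q $ 1 $ j * c $ j + Q $ 1 $ k * c $ k = 0"
     "Q $ 2 $ i * c $ i + Q $ 2 $ j * c $ j + Q $ 2 $ k * c $ k = 0"
     "c $ i + c $ j + c $ k = 0"
    using total[of "\<lambda>l. Q $ 1 $ l"] total[of "\<lambda>l. Q $ 2 $ l"] total[of "\<lambda>l. 1"]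
    by (simp_all add: matrix_vector_mult_def vec_eq_iff)
  have "2 * signed_area Q i j k * c $ k = 0" "2 * signed_area Q i j k * c $ j = 0"
    unfolding signed_area_coords using eqs by algebra+
  then have "c $ k = 0" "c $ j = 0" "c $ i = 0"
    using area eqs(3) by auto
  then have "c = 0" using off by (metis (no_types) insertE emptyE vec_eq_iff zero_index)
  then show "a = b" by (simp add: c_def)
qed

lemma oriented_2_face_exists:
  assumes "consistently_oriented \<Delta> \<omega>" "\<sigma> \<in> m_faces 2 \<Delta>"
  obtains i j k where "\<sigma> = {i, j, k}" "distinct [i, j, k]" "oriented_2_face \<Delta> \<omega> i j k"
proof -
  have "\<omega> \<sigma> \<in> orientations \<sigma>"
    using assms by (simp add: consistently_oriented_def)
  then obtain xs where xs: "distinct xs" "set xs = \<sigma>" "\<omega> \<sigma> = orientation_class xs"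
    by (auto simp: orientations_def quotient_def orderings_def orientation_class_def)
  then have "length xs = 3"
    using assms(2) distinct_card[of xs] by (simp add: m_faces_def)
  then obtain i j k where "xs = [i, j, k]"
    by (auto simp: numeral_3_eq_3 length_Suc_conv)
  with xs assms(2) show thesis
    by (intro that[of i j k]) (auto simp: oriented_2_face_def)
qed

lemma face_in_2_face:
  assumes "pure_2 \<Delta>" "finite \<Delta>" "\<sigma> \<in> \<Delta>"
  obtains \<tau> where "\<tau> \<in> m_faces 2 \<Delta>" "\<sigma> \<subseteq> \<tau>"
proof -
  obtain \<tau> where "\<tau> \<in> \<Delta>" "\<sigma> \<subseteq> \<tau>" "\<forall>\<rho>\<in>\<Delta>. \<tau> \<subseteq> \<rho> \<longrightarrow> \<tau> = \<rho>"
    using finite_has_maximal2[OF assms(2,3)] by blast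
  then have "maximal_face \<Delta> \<tau>"
    by (auto simp: maximal_face_def)
  with assms(1) \<open>\<sigma> \<subseteq> \<tau>\<close> that show thesis by (auto simp: pure_2_def)
qed

section \<open>Embedded complexes\<close>

text \<open>The condition on the associated complex makes the columns distinct: if two vertices were
  mapped to the same point, their pair would be a face, but a degenerate one. Now let the points
  \<open>a\<close> and \<open>b\<close>, in the simplices of \<open>\<sigma>\<close> and \<open>\<tau>\<close>, have the same image. The
  two image simplices then meet in a common face \<open>F\<close>. Its extreme points are columns indexed by
  vertices of \<open>\<sigma>\<close> and also by vertices of \<open>\<tau>\<close>, and these index sets agree as the columns are
  distinct. Thus the common image comes from a point \<open>d\<close> in the simplex of a subset of \<open>\<sigma> \<inter> \<tau>\<close>,
  and injectivity on the single simplices gives \<open>a = d = b\<close>.\<close>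

lemma inj_on_realization_if_M_zero:
  fixes Q :: "real^'n::finite^2"
  assumes M: "Q \<in> M_zero \<Delta>" and vert: "\<And>i. {i} \<in> \<Delta>"
    and inj: "\<And>\<sigma>. \<sigma> \<in> \<Delta> \<Longrightarrow> inj_on ((*v) Q) (barycentric \<sigma>)"
  shows "inj_on ((*v) Q) (standard_realization \<Delta>)"
proof -
  let ?q = "\<lambda>i. column i Q"
  have geo: "geometric_simplicial_complex (realization \<Delta> Q)" and ass: "associated_complex \<Delta> Q = \<Delta>"
    using M by (auto simp: M_zero_def)
  have injq: "inj ?q"
  proof (rule injI)
    fix i k assume eq: "column i Q = column k Q"
    then have "conv_columns Q {i, k} = conv_columns Q {i}"
      by (simp add: conv_columns_def)
    then have "{i, k} \<in> associated_complex \<Delta> Q"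
      using vert[of i] by (auto simp: associated_complex_def realization_def)
    then have "inj_on ?q {i, k}"
      using inj[of "{i, k}"] ass by (simp add: inj_on_barycentric_iff)
    then show "i = k" using eq by (rule inj_onD) auto
  qed
  show ?thesis
  proof (rule inj_onI)
    fix a b assume "a \<in> standard_realization \<Delta>" "b \<in> standard_realization \<Delta>" and eq: "Q *v a = Q *v b"
    then obtain \<sigma> \<tau> where \<sigma>: "\<sigma> \<in> \<Delta>" "a \<in> barycentric \<sigma>" and \<tau>: "\<tau> \<in> \<Delta>" "b \<in> barycentric \<tau>"
      by (auto simp: standard_realization_def)
    define F where "F = conv_columns Q \<sigma> \<inter> conv_columns Q \<tau>"
    have aF: "Q *v a \<in> F"
      unfolding F_def conv_columns_eq using \<sigma>(2) \<tau>(2) eq by (metis IntI imageI)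
    then have face: "F face_of conv_columns Q \<sigma>" "F face_of conv_columns Q \<tau>"
      using geo \<sigma>(1) \<tau>(1) unfolding geometric_simplicial_complex_def realization_def F_def
      by blast+
    have vertices: "\<exists>\<rho>\<subseteq>\<kappa>. F = conv_columns Q \<rho> \<and> ?q ` \<rho> = {x. x extreme_point_of F}"
      if "\<kappa> \<in> \<Delta>" "F face_of conv_columns Q \<kappa>" for \<kappa>
    proof -
      obtain S where S: "S \<subseteq> ?q ` \<kappa>" "F = convex hull S"
        using face_of_convex_hull_subset[of "?q ` \<kappa>" F] \<open>F face_of conv_columns Q \<kappa>\<close>
        by (auto simp: conv_columns_def finite_imp_compact)
      then obtain \<rho> where \<rho>: "\<rho> \<subseteq> \<kappa>" "S = ?q ` \<rho>"
        by (auto simp: subset_image_iff)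
      have "\<not> affine_dependent S"
        using inj[OF that(1)] S(1) by (auto simp: inj_on_barycentric_iff dest: affine_dependent_subset)
      then have "S = {x. x extreme_point_of F}"
        using S(2) by (auto simp: extreme_point_of_convex_hull_affine_independent)
      then show ?thesis using S \<rho> by (auto simp: conv_columns_def)
    qed
    obtain \<rho> where \<rho>: "\<rho> \<subseteq> \<sigma>" "F = conv_columns Q \<rho>" "?q ` \<rho> = {x. x extreme_point_of F}"
      using vertices[OF \<sigma>(1) face(1)] by blast
    obtain \<rho>' where \<rho>': "\<rho>' \<subseteq> \<tau>" "?q ` \<rho>' = {x. x extreme_point_of F}"
      using vertices[OF \<tau>(1) face(2)] by blast
    have "\<rho> = \<rho>'"
      using \<rho>(3) \<rho>'(2) injq by (metis inj_image_eq_iff)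
    obtain d where d: "d \<in> barycentric \<rho>" "Q *v a = Q *v d"
      using aF \<rho>(2) by (auto simp: conv_columns_eq)
    have "a = d"
      using inj[OF \<sigma>(1)] \<sigma>(2) d barycentric_mono[OF \<rho>(1)] by (auto dest: inj_onD)
    moreover have "b = d"
      using inj[OF \<tau>(1)] \<tau>(2) d eq barycentric_mono[OF \<rho>'(1)] \<open>\<rho> = \<rho>'\<close> by (auto dest: inj_onD)
    ultimately show "a = b" by simp
  qed
qed

text \<open>An injective map preserves intersections, so two image simplices meet in the image of the
  simplex of \<open>\<sigma> \<inter> \<tau>\<close>, which is a face of both. For the associated complex, suppose that \<open>\<sigma>\<close> has the
  same convex hull as a face \<open>\<tau>\<close>. The extreme points of that hull are the columns of \<open>\<tau>\<close>, whence
  \<open>\<tau> \<subseteq> \<sigma>\<close>; and each vertex \<open>i\<close> of \<open>\<sigma>\<close> has its column in the hull of \<open>\<tau>\<close>, so that the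
  intersection property for \<open>{i}\<close> and \<open>\<tau>\<close> gives \<open>i \<in> \<tau>\<close>.\<close>

lemma M_zero_if_inj_on_realization:
  fixes Q :: "real^'n::finite^2"
  assumes \<Delta>: "abstract_simplicial_complex \<Delta>" and vert: "\<And>i. {i} \<in> \<Delta>"
    and inj: "inj_on ((*v) Q) (standard_realization \<Delta>)"
  shows "Q \<in> M_zero \<Delta>"
proof -
  let ?q = "\<lambda>i. column i Q"
  have sub: "\<rho> \<in> \<Delta>" if "\<rho> \<subseteq> \<sigma>" "\<rho> \<noteq> {}" "\<sigma> \<in> \<Delta>" for \<rho> \<sigma>
    using \<Delta> that by (auto simp: abstract_simplicial_complex_def)
  have nonempty: "\<sigma> \<noteq> {}" if "\<sigma> \<in> \<Delta>" for \<sigma>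
    using \<Delta> that by (auto simp: abstract_simplicial_complex_def)
  have indep: "inj_on ?q \<sigma>" "\<not> affine_dependent (?q ` \<sigma>)" if "\<sigma> \<in> \<Delta>" for \<sigma>
    using inj_on_subset[OF inj, of "barycentric \<sigma>"] that
    by (auto simp: standard_realization_def inj_on_barycentric_iff)
  have Int: "conv_columns Q \<sigma> \<inter> conv_columns Q \<tau> = conv_columns Q (\<sigma> \<inter> \<tau>)"
    if "\<sigma> \<in> \<Delta>" "\<tau> \<in> \<Delta>" for \<sigma> \<tau>
    unfolding conv_columns_eq barycentric_Int[symmetric]
    by (rule inj_on_image_Int[OF inj, symmetric]) (use that in \<open>auto simp: standard_realization_def\<close>)
  have face: "F face_of conv_columns Q \<sigma> \<longleftrightarrow> (\<exists>\<rho>\<subseteq>\<sigma>. F = conv_columns Q \<rho>)" if "\<sigma> \<in> \<Delta>" for F \<sigma>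
    unfolding conv_columns_def face_of_convex_hull_affine_independent[OF indep(2)[OF that]]
    by (auto simp: subset_image_iff)
  have injq: "inj ?q"
  proof (rule injI)
    fix i j assume "column i Q = column j Q"
    then have "axis i (1::real) = axis j 1"
      using inj_onD[OF inj, of "axis i 1" "axis j 1"] vert
      by (force simp: matrix_mult_axis standard_realization_def intro: axis_in_barycentric)
    then show "i = j" by (simp add: axis_eq_axis)
  qed
  have "geometric_simplicial_complex (realization \<Delta> Q)"
    unfolding geometric_simplicial_complex_def
  proof (intro conjI ballI allI impI)
    show "realization \<Delta> Q \<noteq> {}" "finite (realization \<Delta> Q)"
      using vert by (auto simp: realization_def)
  next
    fix S assume "S \<in> realization \<Delta> Q"
    then obtain \<sigma> where \<sigma>: "\<sigma> \<in> \<Delta>" "S = conv_columns Q \<sigma>"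
      by (auto simp: realization_def)
    show "S \<noteq> {}"
      using \<sigma> nonempty by (simp add: conv_columns_def)
    show "\<exists>n. n simplex S"
      using indep[OF \<sigma>(1)] \<sigma>(2)
      by (auto simp: simplex_def conv_columns_def intro!: exI[of _ "int (card \<sigma>) - 1"] exI[of _ "?q ` \<sigma>"] card_image)
    show "F \<in> realization \<Delta> Q" if F: "F face_of S \<and> F \<noteq> {}" for F
    proof -
      obtain \<rho> where "\<rho> \<subseteq> \<sigma>" "F = conv_columns Q \<rho>"
        using F \<sigma> face by auto
      with F sub[OF _ _ \<sigma>(1)] show ?thesis
        by (auto simp: realization_def conv_columns_def)
    qed
    show "S \<inter> T face_of S" "S \<inter> T face_of T" if T: "T \<in> realization \<Delta> Q" for T
    proof -
      obtain \<tau> where \<tau>: "\<tau> \<in> \<Delta>" "T = conv_columns Q \<tau>"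
        using T by (auto simp: realization_def)
      show "S \<inter> T face_of S" "S \<inter> T face_of T"
        unfolding \<sigma>(2) \<tau>(2) Int[OF \<sigma>(1) \<tau>(1)] face[OF \<sigma>(1)] face[OF \<tau>(1)] by blast+
    qed
  qed
  moreover have "associated_complex \<Delta> Q \<subseteq> \<Delta>"
  proof
    fix \<sigma> assume "\<sigma> \<in> associated_complex \<Delta> Q"
    then obtain \<tau> where \<tau>: "\<tau> \<in> \<Delta>" and eq: "conv_columns Q \<sigma> = conv_columns Q \<tau>"
      by (auto simp: associated_complex_def realization_def)
    have "?q ` \<tau> \<subseteq> ?q ` \<sigma>"
      using extreme_point_of_convex_hull_affine_independent[OF indep(2)[OF \<tau>]] eq
        extreme_point_of_convex_hull[of _ "?q ` \<sigma>"]
      by (auto simp: conv_columns_def)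
    then have "\<tau> \<subseteq> \<sigma>"
      using injq by (simp add: inj_image_subset_iff)
    moreover have "i \<in> \<tau>" if "i \<in> \<sigma>" for i
    proof -
      have "?q i \<in> conv_columns Q {i} \<inter> conv_columns Q \<tau>"
        using that eq[symmetric] by (auto simp: conv_columns_def hull_inc)
      then have "conv_columns Q ({i} \<inter> \<tau>) \<noteq> {}"
        unfolding Int[OF vert \<tau>] by blast
      then have "{i} \<inter> \<tau> \<noteq> {}"
        unfolding conv_columns_def by (metis image_empty convex_hull_empty)
      then show ?thesis by blast
    qed
    ultimately show "\<sigma> \<in> \<Delta>" using \<tau> by (metis subset_antisym subsetI)
  qed
  ultimately show ?thesis
    by (auto simp: M_zero_def associated_complex_def realization_def)
qed

section \<open>The space of meshes and its path components\<close>

text \<open>Each face lies in a 2-face by purity, and the assigned orientation of that 2-face yields a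
  positive, hence non-zero, area. So all faces are non-degenerate, and the two lemmas on
  \<^const>\<open>M_zero\<close> apply.\<close>

lemma M_plus_eq:
  fixes \<Delta> :: "'n::finite set set"
  assumes \<Delta>: "connectivity_complex \<Delta>" "vertex_set \<Delta> = UNIV" and \<omega>: "consistently_oriented \<Delta> \<omega>"
  shows "M_plus \<Delta> \<omega> = {Q. inj_on ((*v) Q) (standard_realization \<Delta>)} \<inter>
    {Q. \<forall>i j k. oriented_2_face \<Delta> \<omega> i j k \<longrightarrow> signed_area Q i j k > 0}"
proof -
  have asc: "abstract_simplicial_complex \<Delta>" and pure: "pure_2 \<Delta>"
    using \<Delta> by (auto simp: connectivity_complex_def simplicial_2_complex_def)
  have vert: "{i} \<in> \<Delta>" for i
  proof -
    have "i \<in> \<Union>\<Delta>"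
      using \<Delta>(2) by (simp add: vertex_set_def)
    then obtain \<sigma> where "\<sigma> \<in> \<Delta>" "i \<in> \<sigma>" ..
    then show ?thesis using asc by (auto simp: abstract_simplicial_complex_def)
  qed
  have "inj_on ((*v) Q) (barycentric \<sigma>)" if Q: "Q \<in> M_plus \<Delta> \<omega>" and "\<sigma> \<in> \<Delta>" for Q \<sigma>
  proof -
    obtain \<tau> where \<tau>: "\<tau> \<in> m_faces 2 \<Delta>" "\<sigma> \<subseteq> \<tau>"
      using face_in_2_face[OF pure _ \<open>\<sigma> \<in> \<Delta>\<close>] by auto
    obtain i j k where ijk: "\<tau> = {i, j, k}" "distinct [i, j, k]" "oriented_2_face \<Delta> \<omega> i j k"
      using oriented_2_face_exists[OF \<omega> \<tau>(1)] by blast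
    then have "signed_area Q i j k \<noteq> 0"
      using Q by (fastforce simp: M_plus_def)
    then show ?thesis
      using inj_on_barycentric_triangle ijk barycentric_mono[OF \<tau>(2)] inj_on_subset by blast
  qed
  then show ?thesis
    using inj_on_realization_if_M_zero[OF _ vert] M_zero_if_inj_on_realization[OF asc vert]
    by (auto simp: M_plus_def)
qed

lemma open_M_plus:
  fixes \<Delta> :: "'n::finite set set"
  assumes "connectivity_complex \<Delta>" "vertex_set \<Delta> = UNIV" "consistently_oriented \<Delta> \<omega>"
  shows "open (M_plus \<Delta> \<omega>)"
proof -
  have area: "signed_area Q i j k =
      ((Q $ 1 $ j - Q $ 1 $ i) * (Q $ 2 $ k - Q $ 2 $ j) - (Q $ 1 $ k - Q $ 1 $ j) * (Q $ 2 $ j - Q $ 2 $ i)) / 2"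
    for Q :: "real^'n^2" and i j k
    using signed_area_coords[of Q i j k] by simp
  have "open {Q :: real^'n^2. 0 < signed_area Q i j k}" for i j k
    unfolding area by (intro open_Collect_less continuous_intros) simp
  then have "open (\<Inter>(i, j, k)\<in>{(i, j, k). oriented_2_face \<Delta> \<omega> i j k}. {Q :: real^'n^2. 0 < signed_area Q i j k})"
    by (intro open_INT) auto
  moreover have "(\<Inter>(i, j, k)\<in>{(i, j, k). oriented_2_face \<Delta> \<omega> i j k}. {Q. 0 < signed_area Q i j k}) =
      {Q. \<forall>i j k. oriented_2_face \<Delta> \<omega> i j k \<longrightarrow> signed_area Q i j k > 0}"
    by auto
  ultimately show ?thesis
    unfolding M_plus_eq[OF assms] by (intro open_Int open_inj_on_realization) simp
qed

lemma mesh_manifold_eq_path_component: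
  "mesh_manifold \<Delta> \<omega> Qref = path_component_set (M_plus \<Delta> \<omega>) Qref"
  unfolding mesh_manifold_def path_component_def[symmetric]
  using path_component_mem(2) by blast

theorem theorem3p13:
  fixes \<Delta> :: "'n::finite set set"
    and \<omega> :: "'n set \<Rightarrow> 'n list set"
    and Qref :: "real^'n^2"
  assumes "connectivity_complex \<Delta>"
    and "vertex_set \<Delta> = UNIV"
    and "consistently_oriented \<Delta> \<omega>"
    and "Qref \<in> M_plus \<Delta> \<omega>"
  shows "(mesh_manifold \<Delta> \<omega> Qref \<in> path_components_of (top_of_set (M_plus \<Delta> \<omega>)) \<and>
          path_connected (mesh_manifold \<Delta> \<omega> Qref)) \<and>
         open (mesh_manifold \<Delta> \<omega> Qref)"
proof -
  have "mesh_manifold \<Delta> \<omega> Qref \<in> path_components_of (top_of_set (M_plus \<Delta> \<omega>))"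
    using assms(4) by (auto simp: mesh_manifold_eq_path_component path_components_of_def)
  then show ?thesis
    using open_path_component[OF open_M_plus[OF assms(1-3)]]
    by (simp add: mesh_manifold_eq_path_component)
qed

end
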